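(* Let $\alpha$ be a set with an involution $\tau\colon\alpha\to\alpha$. Homotopic nanowords over $\alpha$ have homologous $\alpha$-pairings; that is, if two nanowords $(\mathcal{A},w)$ and $(\mathcal{A}',w')$ over $\alpha$ are homotopic, then the associated $\alpha$-pairings $(\{s\}\cup\mathcal{A},s,b_w)$ and $(\{s\}\cup\mathcal{A}',s,b_{w'})$ are homologous.
   Context: Fix a set $\alpha$ with an involution $\tau\colon\alpha\to\alpha$. An $\alpha$-alphabet is a set $\mathcal{A}$ with a map $\mathcal{A}\to\alpha$, $A\mapsto|A|$. A nanoword over $\alpha$ is a pair $(\mathcal{A},w)$, where $\mathcal{A}$ is a finite $\alpha$-alphabet and $w$ is a word (finite sequence) in letters of $\mathcal{A}$ in which every letter of $\mathcal{A}$ appears exactly twice. Two nanowords are isomorphic if there is a bijection of their alphabets commuting with the maps to $\alpha$ that sends the first word letterwise to the second. Homotopy of nanowords is the equivalence relation generated by isomorphisms and the following three moves and their inverses: (i) $(\mathcal{A},xAAy)\mapsto(\mathcal{A}-\{A\},xy)$, where $x,y$ are words on $\mathcal{A}-\{A\}$; (ii) $(\mathcal{A},xAByBAz)\mapsto(\mathcal{A}-\{A,B\},xyz)$ if $|A|=\tau(|B|)$, where $x,y,z$ are words on $\mathcal{A}-\{A,B\}$; (iii) $(\mathcal{A},xAByACzBCt)\mapsto(\mathcal{A},xBAyCAzCBt)$ if $|A|=|B|=|C|$, where $x,y,z,t$ are words on $\mathcal{A}-\{A,B,C\}$. Here $A$, $B$, $C$ are distinct letters of $\mathcal{A}$. Let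 $\pi$ be the abelian group (written multiplicatively) generated by the elements of $\alpha$ subject to $ab=ba$ and $a\tau(a)=1$ for all $a,b\in\alpha$. $\alpha$-pairings: an $\alpha$-pairing is a tuple $(S,s,b)$ consisting of a set $S$, a distinguished element $s\in S$, a map $S-\{s\}\to\alpha$, $A\mapsto|A|$, and a map $b\colon S\times S\to\pi$ that is skew-symmetric: $b(A,B)=b(B,A)^{-1}$ and $b(A,A)=1$ for all $A,B\in S$. An isomorphism of $\alpha$-pairings is a bijection of the underlying sets preserving the distinguished elements, the maps to $\alpha$ and the pairings. An element $A\in S-\{s\}$ is annihilating if $b(A,C)=1$ for all $C\in S$. Two (distinct) elements $A,B\in S-\{s\}$ are twins if $b(A,C)=b(B,C)$ for all $C\in S$ and $|A|=\tau(|B|)$. Homology of $\alpha$-pairings is the equivalence relation generated by isomorphisms, the move $M_1$ (delete an annihilating element from $S$), the move $M_2$ (delete a pair of twins from $S$), and the inverse moves; deletion restricts $b$ and the map to $\alpha$. The $\alpha$-pairing of a nanoword $(\mathcal{A},w)$: set $S=\{s\}\cup\mathcal{A}$ (disjoint union), with the given map $\mathcal{A}\to\alpha$. For $A\in\mathcal{A}$ let $i_A<j_A$ be the two positions of $A$ in $w$. For $A,B\in\mathcal{A}$ put $n_w(A,B)=1$ if $w=\cdots A\cdots B\cdots A\cdots B\cdots$, $n_w(A,B)=-1$ if $w=\cdots B\cdots A\cdots B\cdots A\cdots$, and $n_w(A,B)=0$ in all other cases (in particular $n_w(A,A)=0$). For $D,E\in\mathcal{A}$ put $$D\circ E=\prod_{F\in\mathcal{A},\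 i_D<i_F<j_D,\ i_E<j_F<j_E}|F|\in\pi,\qquad \mathrm{lk}_w(D,E)=(D\circ E)(E\circ D)^{-1}\in\pi.$$ Define $b_w\colon S\times S\to\pi$ by $b_w(s,s)=1$ and, for $A,B\in\mathcal{A}$, $$b_w(A,s)=\prod_{B\in\mathcal{A}}|B|^{n_w(A,B)},\qquad b_w(s,A)=b_w(A,s)^{-1},$$ $$b_w(A,B)=(\mathrm{lk}_w(A,B))^2\,|A|^{n_w(A,B)}\,|B|^{n_w(A,B)}.$$ *)

theory Defs
  imports "HOL-Algebra.Free_Abelian_Groups" "HOL-Library.Sublist"
begin

section \<open>The group \<open>\<pi>\<close>\<close>

text \<open>
  The abelian group generated by \<open>\<alpha>\<close> subject to \<open>a \<tau>(a) = 1\<close>, as a quotient of the free abelian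
  group on \<open>\<alpha>\<close>. The library writes the free abelian group additively; the quotient is used
  multiplicatively.
\<close>

definition pi_relators :: "'a set \<Rightarrow> ('a \<Rightarrow> 'a) \<Rightarrow> ('a \<Rightarrow>\<^sub>0 int) set" where
  "pi_relators \<alpha> \<tau> =
     generate (free_Abelian_group \<alpha>) {frag_of a + frag_of (\<tau> a) | a. a \<in> \<alpha>}"

definition pi_group :: "'a set \<Rightarrow> ('a \<Rightarrow> 'a) \<Rightarrow> ('a \<Rightarrow>\<^sub>0 int) set monoid" where
  "pi_group \<alpha> \<tau> = free_Abelian_group \<alpha> Mod pi_relators \<alpha> \<tau>"

definition pi_gen :: "'a set \<Rightarrow> ('a \<Rightarrow> 'a) \<Rightarrow> 'a \<Rightarrow> ('a \<Rightarrow>\<^sub>0 int) set" where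
  "pi_gen \<alpha> \<tau> a = pi_relators \<alpha> \<tau> #>\<^bsub>free_Abelian_group \<alpha>\<^esub> frag_of a"


section \<open>Nanowords and homotopy\<close>

text \<open>
  The map \<open>proj\<close> is \<open>A \<mapsto> |A|\<close>; only its values on \<open>letters\<close> matter, and nanowords that
  differ merely in the other values are isomorphic. All alphabets are drawn from one
  ambient type \<open>'l\<close>; when \<open>'l\<close> is infinite every nanoword has an isomorphic copy over it, so
  that homotopy over \<open>'l\<close> is homotopy without any restriction on the letters.
\<close>

record ('l, 'a) nanoword =
  letters :: "'l set"
  proj :: "'l \<Rightarrow> 'a"
  word :: "'l list"

definition is_nanoword :: "'a set \<Rightarrow> ('l, 'a) nanoword \<Rightarrow> bool" where
  "is_nanoword \<alpha> N \<longleftrightarrow>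
     finite (letters N) \<and> proj N \<in> letters N \<rightarrow> \<alpha> \<and>
     set (word N) \<subseteq> letters N \<and> (\<forall>A\<in>letters N. count_list (word N) A = 2)"

definition nanoword_iso :: "('l, 'a) nanoword \<Rightarrow> ('l, 'a) nanoword \<Rightarrow> bool" where
  "nanoword_iso N N' \<longleftrightarrow>
     (\<exists>f. bij_betw f (letters N) (letters N') \<and>
          (\<forall>A\<in>letters N. proj N' (f A) = proj N A) \<and>
          map f (word N) = word N')"

inductive nanoword_step ::
  "'a set \<Rightarrow> ('a \<Rightarrow> 'a) \<Rightarrow> ('l, 'a) nanoword \<Rightarrow> ('l, 'a) nanoword \<Rightarrow> bool"
  for \<alpha> \<tau> where
  iso: "\<lbrakk>is_nanoword \<alpha> N; is_nanoword \<alpha> N'; nanoword_iso N N'\<rbrakk> \<Longrightarrow> nanoword_step \<alpha> \<tau> N N'"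
| H1: "\<lbrakk>is_nanoword \<alpha> N; A \<in> letters N;
        word N = x @ [A, A] @ y;
        set x \<union> set y \<subseteq> letters N - {A}\<rbrakk> \<Longrightarrow>
       nanoword_step \<alpha> \<tau> N (N\<lparr>letters := letters N - {A}, word := x @ y\<rparr>)"
| H2: "\<lbrakk>is_nanoword \<alpha> N; A \<in> letters N; B \<in> letters N; A \<noteq> B;
        word N = x @ [A, B] @ y @ [B, A] @ z;
        set x \<union> set y \<union> set z \<subseteq> letters N - {A, B};
        proj N A = \<tau> (proj N B)\<rbrakk> \<Longrightarrow>
       nanoword_step \<alpha> \<tau> N (N\<lparr>letters := letters N - {A, B}, word := x @ y @ z\<rparr>)"
| H3: "\<lbrakk>is_nanoword \<alpha> N; A \<in> letters N; B \<in> letters N; C \<in> letters N; distinct [A, B, C];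
        word N = x @ [A, B] @ y @ [A, C] @ z @ [B, C] @ t;
        set x \<union> set y \<union> set z \<union> set t \<subseteq> letters N - {A, B, C};
        proj N A = proj N B; proj N B = proj N C\<rbrakk> \<Longrightarrow>
       nanoword_step \<alpha> \<tau> N (N\<lparr>word := x @ [B, A] @ y @ [C, A] @ z @ [C, B] @ t\<rparr>)"

definition homotopic ::
  "'a set \<Rightarrow> ('a \<Rightarrow> 'a) \<Rightarrow> ('l, 'a) nanoword \<Rightarrow> ('l, 'a) nanoword \<Rightarrow> bool" where
  "homotopic \<alpha> \<tau> N N' \<longleftrightarrow>
     is_nanoword \<alpha> N \<and> is_nanoword \<alpha> N' \<and> equivclp (nanoword_step \<alpha> \<tau>) N N'"


section \<open>Pairings and homology\<close>

text \<open>
  Only the values of \<open>label\<close> on \<open>elems - {base}\<close> and of \<open>form\<close> on \<open>elems \<times> elems\<close> matter: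
  pairings that differ merely in the other values are isomorphic. Hence deleting elements
  from \<open>elems\<close> restricts \<open>label\<close> and \<open>form\<close>.
\<close>

record ('p, 'a) pairing =
  elems :: "'p set"
  base :: 'p
  label :: "'p \<Rightarrow> 'a"
  form :: "'p \<Rightarrow> 'p \<Rightarrow> ('a \<Rightarrow>\<^sub>0 int) set"

definition is_pairing :: "'a set \<Rightarrow> ('a \<Rightarrow> 'a) \<Rightarrow> ('p, 'a) pairing \<Rightarrow> bool" where
  "is_pairing \<alpha> \<tau> P \<longleftrightarrow>
     base P \<in> elems P \<and> label P \<in> elems P - {base P} \<rightarrow> \<alpha> \<and>
     (\<forall>A\<in>elems P. \<forall>B\<in>elems P. form P A B \<in> carrier (pi_group \<alpha> \<tau>)) \<and>
     (\<forall>A\<in>elems P. \<forall>B\<in>elems P. form P A B = inv\<^bsub>pi_group \<alpha> \<tau>\<^esub> form P B A) \<and>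
     (\<forall>A\<in>elems P. form P A A = \<one>\<^bsub>pi_group \<alpha> \<tau>\<^esub>)"

definition pairing_iso :: "('p, 'a) pairing \<Rightarrow> ('p, 'a) pairing \<Rightarrow> bool" where
  "pairing_iso P P' \<longleftrightarrow>
     (\<exists>f. bij_betw f (elems P) (elems P') \<and> f (base P) = base P' \<and>
          (\<forall>A\<in>elems P - {base P}. label P' (f A) = label P A) \<and>
          (\<forall>A\<in>elems P. \<forall>B\<in>elems P. form P' (f A) (f B) = form P A B))"

definition annihilating :: "'a set \<Rightarrow> ('a \<Rightarrow> 'a) \<Rightarrow> ('p, 'a) pairing \<Rightarrow> 'p \<Rightarrow> bool" where
  "annihilating \<alpha> \<tau> P A \<longleftrightarrow>
     A \<in> elems P - {base P} \<and> (\<forall>C\<in>elems P. form P A C = \<one>\<^bsub>pi_group \<alpha> \<tau>\<^esub>)"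

definition twins :: "('a \<Rightarrow> 'a) \<Rightarrow> ('p, 'a) pairing \<Rightarrow> 'p \<Rightarrow> 'p \<Rightarrow> bool" where
  "twins \<tau> P A B \<longleftrightarrow>
     A \<in> elems P - {base P} \<and> B \<in> elems P - {base P} \<and> A \<noteq> B \<and>
     (\<forall>C\<in>elems P. form P A C = form P B C) \<and> label P A = \<tau> (label P B)"

inductive pairing_step ::
  "'a set \<Rightarrow> ('a \<Rightarrow> 'a) \<Rightarrow> ('p, 'a) pairing \<Rightarrow> ('p, 'a) pairing \<Rightarrow> bool"
  for \<alpha> \<tau> where
  iso: "\<lbrakk>is_pairing \<alpha> \<tau> P; is_pairing \<alpha> \<tau> P'; pairing_iso P P'\<rbrakk> \<Longrightarrow> pairing_step \<alpha> \<tau> P P'"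
| M1: "\<lbrakk>is_pairing \<alpha> \<tau> P; annihilating \<alpha> \<tau> P A\<rbrakk> \<Longrightarrow>
       pairing_step \<alpha> \<tau> P (P\<lparr>elems := elems P - {A}\<rparr>)"
| M2: "\<lbrakk>is_pairing \<alpha> \<tau> P; twins \<tau> P A B\<rbrakk> \<Longrightarrow>
       pairing_step \<alpha> \<tau> P (P\<lparr>elems := elems P - {A, B}\<rparr>)"

definition homologous ::
  "'a set \<Rightarrow> ('a \<Rightarrow> 'a) \<Rightarrow> ('p, 'a) pairing \<Rightarrow> ('p, 'a) pairing \<Rightarrow> bool" where
  "homologous \<alpha> \<tau> P P' \<longleftrightarrow>
     is_pairing \<alpha> \<tau> P \<and> is_pairing \<alpha> \<tau> P' \<and> equivclp (pairing_step \<alpha> \<tau>) P P'"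


section \<open>The pairing of a nanoword\<close>

definition first_pos :: "'l list \<Rightarrow> 'l \<Rightarrow> nat" where
  "first_pos w A = Min {k. k < length w \<and> w ! k = A}"

definition last_pos :: "'l list \<Rightarrow> 'l \<Rightarrow> nat" where
  "last_pos w A = Max {k. k < length w \<and> w ! k = A}"

text \<open>
  If every letter occurs exactly twice, at most one of the two patterns occurs, and neither
  does if \<open>A = B\<close>.
\<close>

definition interlace :: "'l list \<Rightarrow> 'l \<Rightarrow> 'l \<Rightarrow> int" where
  "interlace w A B =
     (if subseq [A, B, A, B] w then 1 else if subseq [B, A, B, A] w then -1 else 0)"

definition circ ::
  "'a set \<Rightarrow> ('a \<Rightarrow> 'a) \<Rightarrow> ('l, 'a) nanoword \<Rightarrow> 'l \<Rightarrow> 'l \<Rightarrow> ('a \<Rightarrow>\<^sub>0 int) set" where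
  "circ \<alpha> \<tau> N D E =
     finprod (pi_group \<alpha> \<tau>) (\<lambda>F. pi_gen \<alpha> \<tau> (proj N F))
       {F \<in> letters N.
          first_pos (word N) D < first_pos (word N) F \<and>
          first_pos (word N) F < last_pos (word N) D \<and>
          first_pos (word N) E < last_pos (word N) F \<and>
          last_pos (word N) F < last_pos (word N) E}"

definition lk ::
  "'a set \<Rightarrow> ('a \<Rightarrow> 'a) \<Rightarrow> ('l, 'a) nanoword \<Rightarrow> 'l \<Rightarrow> 'l \<Rightarrow> ('a \<Rightarrow>\<^sub>0 int) set" where
  "lk \<alpha> \<tau> N D E =
     circ \<alpha> \<tau> N D E \<otimes>\<^bsub>pi_group \<alpha> \<tau>\<^esub> inv\<^bsub>pi_group \<alpha> \<tau>\<^esub> circ \<alpha> \<tau> N E D"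

definition form_base ::
  "'a set \<Rightarrow> ('a \<Rightarrow> 'a) \<Rightarrow> ('l, 'a) nanoword \<Rightarrow> 'l \<Rightarrow> ('a \<Rightarrow>\<^sub>0 int) set" where
  "form_base \<alpha> \<tau> N A =
     finprod (pi_group \<alpha> \<tau>)
       (\<lambda>B. pi_gen \<alpha> \<tau> (proj N B) [^]\<^bsub>pi_group \<alpha> \<tau>\<^esub> interlace (word N) A B) (letters N)"

definition form_letters ::
  "'a set \<Rightarrow> ('a \<Rightarrow> 'a) \<Rightarrow> ('l, 'a) nanoword \<Rightarrow> 'l \<Rightarrow> 'l \<Rightarrow> ('a \<Rightarrow>\<^sub>0 int) set" where
  "form_letters \<alpha> \<tau> N A B =
     (lk \<alpha> \<tau> N A B [^]\<^bsub>pi_group \<alpha> \<tau>\<^esub> (2::nat))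
     \<otimes>\<^bsub>pi_group \<alpha> \<tau>\<^esub> (pi_gen \<alpha> \<tau> (proj N A) [^]\<^bsub>pi_group \<alpha> \<tau>\<^esub> interlace (word N) A B)
     \<otimes>\<^bsub>pi_group \<alpha> \<tau>\<^esub> (pi_gen \<alpha> \<tau> (proj N B) [^]\<^bsub>pi_group \<alpha> \<tau>\<^esub> interlace (word N) A B)"

text \<open>
  The disjoint union \<open>{s} \<union> \<A>\<close> is realised in \<open>'l option\<close>: \<open>None\<close> is \<open>s\<close>, and \<open>Some A\<close> is the
  letter \<open>A\<close>. The value of \<open>label\<close> at \<open>None\<close> is irrelevant.
\<close>

definition nanoword_form ::
  "'a set \<Rightarrow> ('a \<Rightarrow> 'a) \<Rightarrow> ('l, 'a) nanoword \<Rightarrow> 'l option \<Rightarrow> 'l option \<Rightarrow> ('a \<Rightarrow>\<^sub>0 int) set" where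
  "nanoword_form \<alpha> \<tau> N X Y =
     (case (X, Y) of
        (None, None) \<Rightarrow> \<one>\<^bsub>pi_group \<alpha> \<tau>\<^esub>
      | (Some A, None) \<Rightarrow> form_base \<alpha> \<tau> N A
      | (None, Some A) \<Rightarrow> inv\<^bsub>pi_group \<alpha> \<tau>\<^esub> form_base \<alpha> \<tau> N A
      | (Some A, Some B) \<Rightarrow> form_letters \<alpha> \<tau> N A B)"

definition nanoword_pairing ::
  "'a set \<Rightarrow> ('a \<Rightarrow> 'a) \<Rightarrow> ('l, 'a) nanoword \<Rightarrow> ('l option, 'a) pairing" where
  "nanoword_pairing \<alpha> \<tau> N =
     \<lparr>elems = insert None (Some ` letters N),
      base = None,
      label = (\<lambda>X. proj N (the X)),
      form = nanoword_form \<alpha> \<tau> N\<rparr>"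

end

theory Submission
  imports Defs
begin

text \<open>
  The form of a nanoword takes values in \<open>\<pi>\<close>, but its exponents are integers that depend only on
  the order of the occurrences of the letters. They are therefore collected in formal integer
  sums of labels, elements of the free abelian group on \<open>\<alpha>\<close>, and the form is the class of such a sum
  in \<open>\<pi>\<close> (lemma \<open>nanoword_form_eq_pi_class\<close>). The coefficients are built from the indicators
  \<open>u\<^sub>D(F)\<close> and \<open>v\<^sub>D(F)\<close> that the first and the last occurrence of \<open>F\<close> lie between the two
  occurrences of \<open>D\<close>: the interlacing number of \<open>D\<close> and \<open>F\<close> is \<open>u\<^sub>D(F) - v\<^sub>D(F)\<close>, and \<open>|F|\<close> enters the
  linking of \<open>D\<close> and \<open>E\<close> with the exponent \<open>u\<^sub>D(F) v\<^sub>E(F) - u\<^sub>E(F) v\<^sub>D(F)\<close>.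

  Each homotopy move changes these indicators in a controlled way. A letter \<open>A\<close> with adjacent
  occurrences has \<open>u\<^sub>D(A) = v\<^sub>D(A)\<close> for all \<open>D\<close> and encloses nothing; so it is annihilating and
  invisible to the other letters (\<open>homology_H1\<close>). Two letters \<open>A\<close>, \<open>B\<close> cancelled by the second move
  have the same indicators with respect to every other letter, so their contributions are multiples
  of \<open>|A| + |B|\<close>, which vanishes in \<open>\<pi>\<close>, and they are twins (\<open>homology_H2\<close>). The third move
  changes the indicators only among three letters with a common label, and the changes of linking
  and interlacing cancel; the identity on letters is an isomorphism of pairings (\<open>pairing_step_H3\<close>).
  So every homotopy move becomes a homology of pairings, and the theorem follows by induction along
  a chain of moves.
\<close>

section \<open>Classes of formal sums in \<open>\<pi>\<close>\<close>

abbreviation pi_class :: "'a set \<Rightarrow> ('a \<Rightarrow> 'a) \<Rightarrow> ('a \<Rightarrow>\<^sub>0 int) \<Rightarrow> ('a \<Rightarrow>\<^sub>0 int) set" where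
  "pi_class \<alpha> \<tau> x \<equiv> pi_relators \<alpha> \<tau> #>\<^bsub>free_Abelian_group \<alpha>\<^esub> x"

lemma pi_relators_subgroup:
  assumes "\<tau> \<in> \<alpha> \<rightarrow> \<alpha>"
  shows "subgroup (pi_relators \<alpha> \<tau>) (free_Abelian_group \<alpha>)"
  unfolding pi_relators_def
proof (rule group.generate_is_subgroup[OF group_free_Abelian_group])
  show "{frag_of a + frag_of (\<tau> a) |a. a \<in> \<alpha>} \<subseteq> carrier (free_Abelian_group \<alpha>)"
    using assms keys_add by fastforce
qed

lemma pi_relators_normal:
  assumes "\<tau> \<in> \<alpha> \<rightarrow> \<alpha>"
  shows "pi_relators \<alpha> \<tau> \<lhd> free_Abelian_group \<alpha>"
  by (simp add: assms abelian_free_Abelian_group comm_group.subgroup_imp_normal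
      pi_relators_subgroup)

lemma comm_group_pi_group:
  assumes "\<tau> \<in> \<alpha> \<rightarrow> \<alpha>"
  shows "comm_group (pi_group \<alpha> \<tau>)"
  unfolding pi_group_def
  by (intro comm_group.abelian_FactGroup abelian_free_Abelian_group pi_relators_subgroup assms)

lemma pi_class_closed:
  assumes "Poly_Mapping.keys x \<subseteq> \<alpha>"
  shows "pi_class \<alpha> \<tau> x \<in> carrier (pi_group \<alpha> \<tau>)"
  using assms by (simp add: pi_group_def carrier_FactGroup)

lemma pi_class_add:
  assumes "\<tau> \<in> \<alpha> \<rightarrow> \<alpha>" "Poly_Mapping.keys x \<subseteq> \<alpha>" "Poly_Mapping.keys y \<subseteq> \<alpha>"
  shows "pi_class \<alpha> \<tau> (x + y) = pi_class \<alpha> \<tau> x \<otimes>\<^bsub>pi_group \<alpha> \<tau>\<^esub> pi_class \<alpha> \<tau> y"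
  using normal.rcos_sum[OF pi_relators_normal[OF assms(1)], of x y] assms
  by (simp add: pi_group_def)

lemma pi_class_relator:
  assumes "\<tau> \<in> \<alpha> \<rightarrow> \<alpha>" "x \<in> pi_relators \<alpha> \<tau>"
  shows "pi_class \<alpha> \<tau> x = \<one>\<^bsub>pi_group \<alpha> \<tau>\<^esub>"
proof -
  have "Poly_Mapping.keys x \<subseteq> \<alpha>"
    using subgroup.mem_carrier[OF pi_relators_subgroup] assms by fastforce
  then show ?thesis
    using assms pi_relators_subgroup[OF assms(1)]
    by (simp add: pi_group_def group.coset_join2)
qed

lemma pi_class_zero:
  assumes "\<tau> \<in> \<alpha> \<rightarrow> \<alpha>"
  shows "pi_class \<alpha> \<tau> 0 = \<one>\<^bsub>pi_group \<alpha> \<tau>\<^esub>"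
  using subgroup.one_closed[OF pi_relators_subgroup[OF assms]]
  by (intro pi_class_relator assms) simp

lemma pi_class_cmul:
  assumes "\<tau> \<in> \<alpha> \<rightarrow> \<alpha>" "Poly_Mapping.keys x \<subseteq> \<alpha>"
  shows "pi_class \<alpha> \<tau> (frag_cmul n x) = pi_class \<alpha> \<tau> x [^]\<^bsub>pi_group \<alpha> \<tau>\<^esub> (n::int)"
  using normal.FactGroup_int_pow[OF pi_relators_normal[OF assms(1)], of x n] assms
  by (simp add: pi_group_def)

lemma pi_class_uminus:
  assumes "\<tau> \<in> \<alpha> \<rightarrow> \<alpha>" "Poly_Mapping.keys x \<subseteq> \<alpha>"
  shows "pi_class \<alpha> \<tau> (- x) = inv\<^bsub>pi_group \<alpha> \<tau>\<^esub> pi_class \<alpha> \<tau> x"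
proof -
  interpret comm_group "pi_group \<alpha> \<tau>" by (rule comm_group_pi_group[OF assms(1)])
  have "pi_class \<alpha> \<tau> (- x) \<otimes>\<^bsub>pi_group \<alpha> \<tau>\<^esub> pi_class \<alpha> \<tau> x = \<one>\<^bsub>pi_group \<alpha> \<tau>\<^esub>"
    using pi_class_add[of \<tau> \<alpha> "- x" x] pi_class_zero[of \<tau> \<alpha>] assms by simp
  then show ?thesis
    using assms by (intro inv_equality[symmetric] pi_class_closed) auto
qed

lemma pi_class_sum:
  assumes "\<tau> \<in> \<alpha> \<rightarrow> \<alpha>" "finite I" "\<And>i. i \<in> I \<Longrightarrow> Poly_Mapping.keys (f i) \<subseteq> \<alpha>"
  shows "pi_class \<alpha> \<tau> (\<Sum>i\<in>I. f i) = finprod (pi_group \<alpha> \<tau>) (\<lambda>i. pi_class \<alpha> \<tau> (f i)) I"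
  using assms(2,3)
proof (induction I rule: finite_induct)
  case empty
  interpret comm_group "pi_group \<alpha> \<tau>" by (rule comm_group_pi_group[OF assms(1)])
  show ?case by (simp add: pi_class_zero assms(1))
next
  case (insert i I)
  interpret comm_group "pi_group \<alpha> \<tau>" by (rule comm_group_pi_group[OF assms(1)])
  have "Poly_Mapping.keys (sum f I) \<subseteq> \<alpha>"
    using insert sum_closed_free_Abelian_group[of I f \<alpha>] by simp
  moreover have "(\<lambda>i. pi_class \<alpha> \<tau> (f i)) \<in> I \<rightarrow> carrier (pi_group \<alpha> \<tau>)"
    using insert.prems by (auto intro!: pi_class_closed)
  ultimately show ?case
    using insert by (simp add: pi_class_add assms(1) pi_class_closed)
qed

text \<open>
  The sole way in which the relations of \<open>\<pi>\<close> enter: formal sums that differ by a multiple of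
  \<open>a + \<tau>(a)\<close> are identified. This happens only for the second homotopy move, where the two
  cancelled letters have labels \<open>\<tau>(a)\<close> and \<open>a\<close>.
\<close>

lemma pi_class_add_relator:
  assumes "\<tau> \<in> \<alpha> \<rightarrow> \<alpha>" "Poly_Mapping.keys x \<subseteq> \<alpha>" "a \<in> \<alpha>"
  shows "pi_class \<alpha> \<tau> (x + frag_cmul n (frag_of a + frag_of (\<tau> a))) = pi_class \<alpha> \<tau> x"
proof -
  interpret comm_group "pi_group \<alpha> \<tau>" by (rule comm_group_pi_group[OF assms(1)])
  have "frag_of a + frag_of (\<tau> a) \<in> pi_relators \<alpha> \<tau>"
    unfolding pi_relators_def using assms(3) by (intro generate.incl) blast
  then have "pi_class \<alpha> \<tau> (frag_of a + frag_of (\<tau> a)) = \<one>\<^bsub>pi_group \<alpha> \<tau>\<^esub>"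
    by (intro pi_class_relator assms)
  moreover have "Poly_Mapping.keys (frag_of a + frag_of (\<tau> a)) \<subseteq> \<alpha>"
    using assms keys_add by fastforce
  ultimately have "pi_class \<alpha> \<tau> (frag_cmul n (frag_of a + frag_of (\<tau> a))) = \<one>\<^bsub>pi_group \<alpha> \<tau>\<^esub>"
      "Poly_Mapping.keys (frag_cmul n (frag_of a + frag_of (\<tau> a))) \<subseteq> \<alpha>"
    using keys_cmul[of n "frag_of a + frag_of (\<tau> a)"] by (auto simp: pi_class_cmul assms(1))
  then show ?thesis
    by (simp add: pi_class_add pi_class_closed assms)
qed

section \<open>Positions of letters\<close>

definition positions :: "'l list \<Rightarrow> 'l \<Rightarrow> nat set" where
  "positions w A = {k. k < length w \<and> w ! k = A}"

lemma first_pos_eq_Min: "first_pos w A = Min (positions w A)"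
  and last_pos_eq_Max: "last_pos w A = Max (positions w A)"
  by (simp_all add: first_pos_def last_pos_def positions_def)

lemma card_positions: "card (positions w A) = count_list w A"
  unfolding positions_def count_list_eq_length_filter length_filter_conv_card
  by (rule arg_cong[where f = card]) auto

lemma positions_of_two:
  assumes "count_list w A = 2"
  shows "positions w A = {first_pos w A, last_pos w A}" "first_pos w A < last_pos w A"
proof -
  obtain p q where pq: "positions w A = {p, q}" "p \<noteq> q"
    using assms card_positions[of w A] by (metis card_2_iff)
  show "positions w A = {first_pos w A, last_pos w A}" "first_pos w A < last_pos w A"
    unfolding first_pos_eq_Min last_pos_eq_Max pq(1) using pq(2) by (auto simp: min_def max_def)
qed

lemma first_last_pos_eqI:
  assumes "count_list w A = 2" "p < q" "q < length w" "w ! p = A" "w ! q = A"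
  shows "first_pos w A = p" "last_pos w A = q"
proof -
  have "p \<in> positions w A" "q \<in> positions w A"
    using assms by (auto simp: positions_def)
  then show "first_pos w A = p" "last_pos w A = q"
    using positions_of_two[OF assms(1)] assms(2) by auto
qed

lemma nth_first_last_pos:
  assumes "count_list w A = 2"
  shows "w ! first_pos w A = A" "w ! last_pos w A = A" "last_pos w A < length w"
proof -
  have "first_pos w A \<in> positions w A" "last_pos w A \<in> positions w A"
    using positions_of_two(1)[OF assms] by auto
  then show "w ! first_pos w A = A" "w ! last_pos w A = A" "last_pos w A < length w"
    by (auto simp: positions_def)
qed

text \<open>
  Every quantity in the pairing is a polynomial in two indicators: the first, respectively the
  last, occurrence of \<open>F\<close> lies strictly between the two occurrences of \<open>D\<close>. Interlacing is
  \<open>encl_first - encl_last\<close>, and the exponent of \<open>|F|\<close> in the linking of \<open>D\<close> and \<open>E\<close> is a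
  \<open>2 \<times> 2\<close> determinant of these indicators. They are integers so that the case distinctions on
  positions become arithmetic.
\<close>

definition encl_first :: "'l list \<Rightarrow> 'l \<Rightarrow> 'l \<Rightarrow> int" where
  "encl_first w D F = of_bool (first_pos w D < first_pos w F \<and> first_pos w F < last_pos w D)"

definition encl_last :: "'l list \<Rightarrow> 'l \<Rightarrow> 'l \<Rightarrow> int" where
  "encl_last w D F = of_bool (first_pos w D < last_pos w F \<and> last_pos w F < last_pos w D)"

lemma subseq_Cons_drop_iff:
  "subseq (a # l) (drop n w) \<longleftrightarrow>
    (\<exists>k. n \<le> k \<and> k < length w \<and> w ! k = a \<and> subseq l (drop (Suc k) w))"
proof
  assume "subseq (a # l) (drop n w)"
  then obtain us vs where split: "drop n w = us @ a # vs" "subseq l vs"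
    by (auto dest: list_emb_ConsD)
  have len: "n + length us < length w"
    using arg_cong[OF split(1), of length] by simp
  have "w ! (n + length us) = drop n w ! length us"
    using len by simp
  then have "w ! (n + length us) = a"
    by (simp add: split(1))
  moreover have "drop (Suc (n + length us)) w = vs"
    using arg_cong[OF split(1), of "drop (Suc (length us))"] by (simp add: add.commute)
  ultimately show "\<exists>k. n \<le> k \<and> k < length w \<and> w ! k = a \<and> subseq l (drop (Suc k) w)"
    using len split(2) by (intro exI[of _ "n + length us"]) auto
next
  assume "\<exists>k. n \<le> k \<and> k < length w \<and> w ! k = a \<and> subseq l (drop (Suc k) w)"
  then obtain k where k: "n \<le> k" "k < length w" "w ! k = a" "subseq l (drop (Suc k) w)"
    by blast
  then have "subseq (a # l) (drop k w)"
    by (simp flip: Cons_nth_drop_Suc)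
  moreover have "drop n w = take (k - n) (drop n w) @ drop k w"
    using k(1) append_take_drop_id[of "k - n" "drop n w"] by simp
  ultimately show "subseq (a # l) (drop n w)"
    by (metis list_emb_append2)
qed

lemma subseq_alternating_iff:
  assumes "count_list w A = 2" "count_list w B = 2"
  shows "subseq [A, B, A, B] w \<longleftrightarrow>
    first_pos w A < first_pos w B \<and> first_pos w B < last_pos w A \<and> last_pos w A < last_pos w B"
    (is "?L \<longleftrightarrow> ?R")
proof -
  have "?L \<longleftrightarrow> subseq [A, B, A, B] (drop 0 w)" by simp
  also have "\<dots> \<longleftrightarrow> (\<exists>k1\<in>positions w A. \<exists>k2\<in>positions w B. \<exists>k3\<in>positions w A. \<exists>k4\<in>positions w B.
      k1 < k2 \<and> k2 < k3 \<and> k3 < k4)"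
    unfolding subseq_Cons_drop_iff positions_def Suc_le_eq by auto
  also have "\<dots> \<longleftrightarrow> ?R"
    unfolding positions_of_two(1)[OF assms(1)] positions_of_two(1)[OF assms(2)]
    using positions_of_two(2)[OF assms(1)] positions_of_two(2)[OF assms(2)] by auto
  finally show ?thesis .
qed

text \<open>
  Of the two occurrences of \<open>B\<close>, either both, none or one lie between those of \<open>A\<close>; only in the
  last case do the letters interlace, and the sign records which of the two it is.
\<close>

lemma interlace_eq:
  assumes "count_list w A = 2" "count_list w B = 2"
  shows "interlace w A B = encl_first w A B - encl_last w A B"
proof (cases "A = B")
  case True
  have "\<not> subseq [A, A, A, A] w"
    by (simp add: subseq_alternating_iff assms)
  with True show ?thesis
    by (simp add: interlace_def encl_first_def encl_last_def)
next
  case False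
  have "first_pos w A \<noteq> first_pos w B" "first_pos w A \<noteq> last_pos w B"
    "last_pos w A \<noteq> first_pos w B" "last_pos w A \<noteq> last_pos w B"
    using False nth_first_last_pos[OF assms(1)] nth_first_last_pos[OF assms(2)] by metis+
  then show ?thesis
    using positions_of_two(2)[OF assms(1)] positions_of_two(2)[OF assms(2)]
    unfolding interlace_def encl_first_def encl_last_def
      subseq_alternating_iff[OF assms] subseq_alternating_iff[OF assms(2,1)]
    by (auto simp: of_bool_def)
qed

text \<open>
  With the antisymmetry of the determinants that give the linking, this makes the whole pairing
  skew-symmetric. For distinct letters the four positions are distinct, which excludes the
  boundary cases.
\<close>

lemma encl_skew:
  assumes "count_list w A = 2" "count_list w B = 2"
  shows "encl_first w A B - encl_last w A B = - (encl_first w B A - encl_last w B A)"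
proof (cases "A = B")
  case True
  then show ?thesis
    by (simp add: encl_first_def encl_last_def)
next
  case False
  have "first_pos w A \<noteq> first_pos w B" "first_pos w A \<noteq> last_pos w B"
    "last_pos w A \<noteq> first_pos w B" "last_pos w A \<noteq> last_pos w B"
    using False nth_first_last_pos[OF assms(1)] nth_first_last_pos[OF assms(2)] by metis+
  then show ?thesis
    using positions_of_two(2)[OF assms(1)] positions_of_two(2)[OF assms(2)]
    unfolding encl_first_def encl_last_def
    by (auto simp: of_bool_def)
qed

section \<open>The pairing as a class of formal sums\<close>

lemma is_nanowordD:
  assumes "is_nanoword \<alpha> N"
  shows "finite (letters N)" "A \<in> letters N \<Longrightarrow> proj N A \<in> \<alpha>"
    "A \<in> letters N \<Longrightarrow> count_list (word N) A = 2"
  using assms by (auto simp: is_nanoword_def)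

text \<open>
  The values \<open>lk\<close>, \<open>form_base\<close> and \<open>form_letters\<close> lifted from \<open>\<pi>\<close> to the free abelian group. There,
  identities can be checked coefficient by coefficient, and the relations of \<open>\<pi>\<close> are left to the
  place where they are needed.
\<close>

definition link_sum :: "('l, 'a) nanoword \<Rightarrow> 'l \<Rightarrow> 'l \<Rightarrow> 'a \<Rightarrow>\<^sub>0 int" where
  "link_sum N D E = (\<Sum>F\<in>letters N. frag_cmul
     (encl_first (word N) D F * encl_last (word N) E F - encl_first (word N) E F * encl_last (word N) D F)
     (frag_of (proj N F)))"

definition base_sum :: "('l, 'a) nanoword \<Rightarrow> 'l \<Rightarrow> 'a \<Rightarrow>\<^sub>0 int" where
  "base_sum N D = (\<Sum>F\<in>letters N. frag_cmul
     (encl_first (word N) D F - encl_last (word N) D F) (frag_of (proj N F)))"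

definition letter_sum :: "('l, 'a) nanoword \<Rightarrow> 'l \<Rightarrow> 'l \<Rightarrow> 'a \<Rightarrow>\<^sub>0 int" where
  "letter_sum N D E = frag_cmul 2 (link_sum N D E)
     + frag_cmul (encl_first (word N) D E - encl_last (word N) D E)
         (frag_of (proj N D) + frag_of (proj N E))"

fun free_form :: "('l, 'a) nanoword \<Rightarrow> 'l option \<Rightarrow> 'l option \<Rightarrow> 'a \<Rightarrow>\<^sub>0 int" where
  "free_form N None None = 0"
| "free_form N (Some D) None = base_sum N D"
| "free_form N None (Some D) = - base_sum N D"
| "free_form N (Some D) (Some E) = letter_sum N D E"

lemma keys_add_subset:
  "\<lbrakk>Poly_Mapping.keys x \<subseteq> S; Poly_Mapping.keys y \<subseteq> S\<rbrakk> \<Longrightarrow> Poly_Mapping.keys (x + y) \<subseteq> S"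
  using keys_add[of x y] by blast

lemma keys_cmul_subset:
  "Poly_Mapping.keys x \<subseteq> S \<Longrightarrow> Poly_Mapping.keys (frag_cmul n x) \<subseteq> S"
  using keys_cmul[of n x] by blast

lemma keys_sum_subset:
  fixes f :: "'i \<Rightarrow> 'a \<Rightarrow>\<^sub>0 int"
  shows "(\<And>i. i \<in> I \<Longrightarrow> Poly_Mapping.keys (f i) \<subseteq> S) \<Longrightarrow> Poly_Mapping.keys (sum f I) \<subseteq> S"
  using sum_closed_free_Abelian_group[of I f S] by simp

lemmas keys_subset_intros = keys_add_subset keys_cmul_subset keys_sum_subset

lemma keys_link_sum:
  assumes "is_nanoword \<alpha> N"
  shows "Poly_Mapping.keys (link_sum N D E) \<subseteq> \<alpha>"
  unfolding link_sum_def
  by (intro keys_subset_intros) (use is_nanowordD(2)[OF assms] in auto)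

lemma keys_base_sum:
  assumes "is_nanoword \<alpha> N"
  shows "Poly_Mapping.keys (base_sum N D) \<subseteq> \<alpha>"
  unfolding base_sum_def
  by (intro keys_subset_intros) (use is_nanowordD(2)[OF assms] in auto)

lemma keys_free_form:
  assumes "is_nanoword \<alpha> N"
    and "X \<in> insert None (Some ` letters N)" "Y \<in> insert None (Some ` letters N)"
  shows "Poly_Mapping.keys (free_form N X Y) \<subseteq> \<alpha>"
proof -
  have "Poly_Mapping.keys (letter_sum N D E) \<subseteq> \<alpha>" if "D \<in> letters N" "E \<in> letters N" for D E
    unfolding letter_sum_def
    by (intro keys_subset_intros keys_link_sum assms) (use is_nanowordD(2)[OF assms(1)] that in auto)
  then show ?thesis
    using assms(2,3) keys_base_sum[OF assms(1)] by (elim insertE imageE) simp_all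
qed

text \<open>
  The product over the letters that satisfy two enclosure conditions is the sum over all letters
  with the product of the two indicators as coefficient.
\<close>

lemma circ_eq_pi_class:
  assumes "\<tau> \<in> \<alpha> \<rightarrow> \<alpha>" "is_nanoword \<alpha> N"
  shows "circ \<alpha> \<tau> N D E = pi_class \<alpha> \<tau> (\<Sum>F\<in>letters N. frag_cmul
     (encl_first (word N) D F * encl_last (word N) E F) (frag_of (proj N F)))"
proof -
  let ?S = "{F \<in> letters N.
          first_pos (word N) D < first_pos (word N) F \<and>
          first_pos (word N) F < last_pos (word N) D \<and>
          first_pos (word N) E < last_pos (word N) F \<and>
          last_pos (word N) F < last_pos (word N) E}"
  have "circ \<alpha> \<tau> N D E = pi_class \<alpha> \<tau> (\<Sum>F\<in>?S. frag_of (proj N F))"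
    unfolding circ_def pi_gen_def
    by (subst pi_class_sum) (use assms is_nanowordD[OF assms(2)] in auto)
  also have "(\<Sum>F\<in>?S. frag_of (proj N F)) = (\<Sum>F\<in>letters N. frag_cmul
     (encl_first (word N) D F * encl_last (word N) E F) (frag_of (proj N F)))"
    using is_nanowordD(1)[OF assms(2)]
    by (subst sum.inter_filter) (auto simp: encl_first_def encl_last_def of_bool_def intro!: sum.cong)
  finally show ?thesis .
qed

lemma lk_eq_pi_class:
  assumes "\<tau> \<in> \<alpha> \<rightarrow> \<alpha>" "is_nanoword \<alpha> N"
  shows "lk \<alpha> \<tau> N D E = pi_class \<alpha> \<tau> (link_sum N D E)"
proof -
  let ?c = "\<lambda>D E. \<Sum>F\<in>letters N. frag_cmul
     (encl_first (word N) D F * encl_last (word N) E F) (frag_of (proj N F))"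
  have keys: "Poly_Mapping.keys (?c D E) \<subseteq> \<alpha>" for D E
    by (intro keys_subset_intros) (use is_nanowordD(2)[OF assms(2)] in auto)
  have "link_sum N D E = ?c D E + - ?c E D"
    by (simp add: link_sum_def frag_cmul_diff_distrib sum_subtractf)
  moreover have "pi_class \<alpha> \<tau> (?c D E + - ?c E D)
      = pi_class \<alpha> \<tau> (?c D E) \<otimes>\<^bsub>pi_group \<alpha> \<tau>\<^esub> inv\<^bsub>pi_group \<alpha> \<tau>\<^esub> pi_class \<alpha> \<tau> (?c E D)"
    using keys by (simp add: pi_class_add pi_class_uminus assms(1) del: add_uminus_conv_diff)
  ultimately show ?thesis
    by (simp add: lk_def circ_eq_pi_class assms)
qed

text \<open>
  This reduces the theorem to identities between formal sums, up to multiples of \<open>a + \<tau>(a)\<close>.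
\<close>

lemma nanoword_form_eq_pi_class:
  assumes "\<tau> \<in> \<alpha> \<rightarrow> \<alpha>" "is_nanoword \<alpha> N"
    and "X \<in> insert None (Some ` letters N)" "Y \<in> insert None (Some ` letters N)"
  shows "nanoword_form \<alpha> \<tau> N X Y = pi_class \<alpha> \<tau> (free_form N X Y)"
proof -
  interpret comm_group "pi_group \<alpha> \<tau>" by (rule comm_group_pi_group[OF assms(1)])
  note nw = is_nanowordD[OF assms(2)]
  have base: "form_base \<alpha> \<tau> N D = pi_class \<alpha> \<tau> (base_sum N D)" if "D \<in> letters N" for D
  proof -
    have "pi_class \<alpha> \<tau> (base_sum N D) = finprod (pi_group \<alpha> \<tau>) (\<lambda>F. pi_class \<alpha> \<tau> (frag_cmul
        (encl_first (word N) D F - encl_last (word N) D F) (frag_of (proj N F)))) (letters N)"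
      unfolding base_sum_def using assms(1) nw
      by (intro pi_class_sum keys_cmul_subset) auto
    also have "\<dots> = form_base \<alpha> \<tau> N D"
      unfolding form_base_def pi_gen_def
    proof (rule finprod_cong')
      show "(\<lambda>F. pi_class \<alpha> \<tau> (frag_of (proj N F)) [^]\<^bsub>pi_group \<alpha> \<tau>\<^esub> interlace (word N) D F)
          \<in> letters N \<rightarrow> carrier (pi_group \<alpha> \<tau>)"
        using nw(2) by (auto intro!: int_pow_closed pi_class_closed)
    qed (use nw that in \<open>simp_all add: interlace_eq pi_class_cmul assms(1)\<close>)
    finally show ?thesis by simp
  qed
  have letters: "form_letters \<alpha> \<tau> N D E = pi_class \<alpha> \<tau> (letter_sum N D E)"
    if "D \<in> letters N" "E \<in> letters N" for D E
  proof -
    let ?n = "encl_first (word N) D E - encl_last (word N) D E"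
    have "letter_sum N D E = frag_cmul 2 (link_sum N D E) + frag_cmul ?n (frag_of (proj N D))
        + frag_cmul ?n (frag_of (proj N E))"
      by (simp add: letter_sum_def frag_cmul_distrib2)
    moreover have "lk \<alpha> \<tau> N D E [^]\<^bsub>pi_group \<alpha> \<tau>\<^esub> (2::nat) = pi_class \<alpha> \<tau> (frag_cmul 2 (link_sum N D E))"
      using int_pow_int[of "pi_group \<alpha> \<tau>" "lk \<alpha> \<tau> N D E" 2]
      by (simp add: pi_class_cmul lk_eq_pi_class assms(1,2) keys_link_sum)
    moreover have "pi_class \<alpha> \<tau> (frag_cmul ?n (frag_of (proj N F)))
        = pi_gen \<alpha> \<tau> (proj N F) [^]\<^bsub>pi_group \<alpha> \<tau>\<^esub> interlace (word N) D E" if "F \<in> {D, E}" for F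
      using nw that \<open>D \<in> letters N\<close> \<open>E \<in> letters N\<close> unfolding pi_gen_def
      by (subst pi_class_cmul) (auto simp: interlace_eq assms(1))
    moreover have "Poly_Mapping.keys (frag_cmul 2 (link_sum N D E)) \<subseteq> \<alpha>"
      "Poly_Mapping.keys (frag_cmul ?n (frag_of (proj N D))) \<subseteq> \<alpha>"
      "Poly_Mapping.keys (frag_cmul ?n (frag_of (proj N E))) \<subseteq> \<alpha>"
      using nw(2) that by (auto intro!: keys_cmul_subset keys_link_sum assms simp del: keys_cmul_iff)
    ultimately show ?thesis
      by (simp only: form_letters_def pi_class_add[OF assms(1)] keys_add_subset insert_iff simp_thms)
  qed
  show ?thesis
    using assms(3,4)
    by (elim insertE imageE)
      (simp_all add: nanoword_form_def base letters pi_class_zero pi_class_uminus assms(1)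
        keys_base_sum[OF assms(2)])
qed

lemma free_form_skew:
  assumes "is_nanoword \<alpha> N"
    and "X \<in> insert None (Some ` letters N)" "Y \<in> insert None (Some ` letters N)"
  shows "free_form N X Y = - free_form N Y X"
proof -
  have letter: "letter_sum N D E = - letter_sum N E D" if "D \<in> letters N" "E \<in> letters N" for D E
  proof -
    have "link_sum N D E = - link_sum N E D"
      by (simp add: link_sum_def frag_cmul_diff_distrib sum_subtractf)
    moreover have "encl_first (word N) D E - encl_last (word N) D E
        = - (encl_first (word N) E D - encl_last (word N) E D)"
      using is_nanowordD(3)[OF assms(1)] that by (intro encl_skew) auto
    ultimately show ?thesis
      by (simp only: letter_sum_def) (intro poly_mapping_eqI, simp add: lookup_add add.commute)
  qed
  show ?thesis
    using assms(2,3) letter[of "the X" "the Y"] by (elim insertE imageE) simp_all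
qed

lemma free_form_diagonal: "free_form N X X = 0"
proof -
  have "link_sum N D D = 0" for D
    by (simp add: link_sum_def)
  then have "letter_sum N D D = 0" for D
    by (simp add: letter_sum_def encl_first_def encl_last_def)
  then show ?thesis
    by (cases X) auto
qed

lemma nanoword_pairing_select [simp]:
  "elems (nanoword_pairing \<alpha> \<tau> N) = insert None (Some ` letters N)"
  "base (nanoword_pairing \<alpha> \<tau> N) = None"
  "label (nanoword_pairing \<alpha> \<tau> N) = (\<lambda>X. proj N (the X))"
  "form (nanoword_pairing \<alpha> \<tau> N) = nanoword_form \<alpha> \<tau> N"
  by (simp_all add: nanoword_pairing_def)

text \<open>
  Skew-symmetry and the vanishing diagonal hold already for the formal sums, before any relation
  of \<open>\<pi>\<close> is imposed.
\<close>

lemma is_pairing_nanoword_pairing: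
  assumes "\<tau> \<in> \<alpha> \<rightarrow> \<alpha>" "is_nanoword \<alpha> N"
  shows "is_pairing \<alpha> \<tau> (nanoword_pairing \<alpha> \<tau> N)"
proof -
  let ?S = "insert None (Some ` letters N)"
  let ?G = "pi_group \<alpha> \<tau>"
  have form: "nanoword_form \<alpha> \<tau> N X Y \<in> carrier ?G"
    "nanoword_form \<alpha> \<tau> N X Y = inv\<^bsub>?G\<^esub> nanoword_form \<alpha> \<tau> N Y X"
    "nanoword_form \<alpha> \<tau> N X X = \<one>\<^bsub>?G\<^esub>"
    if X: "X \<in> ?S" and Y: "Y \<in> ?S" for X Y
  proof -
    show "nanoword_form \<alpha> \<tau> N X Y \<in> carrier ?G"
      by (simp only: nanoword_form_eq_pi_class assms X Y)
        (intro pi_class_closed keys_free_form assms X Y)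
    show "nanoword_form \<alpha> \<tau> N X Y = inv\<^bsub>?G\<^esub> nanoword_form \<alpha> \<tau> N Y X"
      by (simp only: nanoword_form_eq_pi_class[OF assms X Y] nanoword_form_eq_pi_class[OF assms Y X]
          free_form_skew[OF assms(2) X Y] pi_class_uminus[OF assms(1) keys_free_form[OF assms(2) Y X]])
    show "nanoword_form \<alpha> \<tau> N X X = \<one>\<^bsub>?G\<^esub>"
      by (simp only: nanoword_form_eq_pi_class[OF assms X X] free_form_diagonal pi_class_zero[OF assms(1)])
  qed
  have label: "(\<lambda>X. proj N (the X)) \<in> ?S - {None} \<rightarrow> \<alpha>"
    using is_nanowordD(2)[OF assms(2)] by auto
  show ?thesis
    unfolding is_pairing_def nanoword_pairing_select
    by (intro conjI ballI label form insertI1)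
qed

lemma is_pairing_restrict:
  assumes "is_pairing \<alpha> \<tau> P" "S \<subseteq> elems P" "base P \<in> S"
  shows "is_pairing \<alpha> \<tau> (P\<lparr>elems := S\<rparr>)"
proof -
  have sel: "base (P\<lparr>elems := S\<rparr>) = base P" "label (P\<lparr>elems := S\<rparr>) = label P"
    "form (P\<lparr>elems := S\<rparr>) = form P" "elems (P\<lparr>elems := S\<rparr>) = S"
    by simp_all
  have "label P \<in> S - {base P} \<rightarrow> \<alpha>"
    using assms(1,2) unfolding is_pairing_def by (auto simp only: Pi_iff)
  then show ?thesis
    using assms unfolding is_pairing_def sel by (meson subsetD)
qed

text \<open>
  A cancelling homotopy move becomes the deletion of its letters from the pairing followed by an
  isomorphism: the restricted form of \<open>N\<close> and the form of \<open>N'\<close> are different functions that agree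
  on the remaining letters.
\<close>

lemma homology_of_deletion:
  fixes N N' :: "('l, 'a) nanoword"
  assumes tau: "\<tau> \<in> \<alpha> \<rightarrow> \<alpha>" and nw: "is_nanoword \<alpha> N" and nw': "is_nanoword \<alpha> N'"
    and sel: "letters N' = letters N - Z" "proj N' = proj N"
    and same: "\<And>X Y. \<lbrakk>X \<in> insert None (Some ` letters N'); Y \<in> insert None (Some ` letters N')\<rbrakk> \<Longrightarrow>
      pi_class \<alpha> \<tau> (free_form N X Y) = pi_class \<alpha> \<tau> (free_form N' X Y)"
    and del: "pairing_step \<alpha> \<tau> (nanoword_pairing \<alpha> \<tau> N)
      ((nanoword_pairing \<alpha> \<tau> N)\<lparr>elems := elems (nanoword_pairing \<alpha> \<tau> N) - Some ` Z\<rparr>)"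
  shows "equivclp (pairing_step \<alpha> \<tau>) (nanoword_pairing \<alpha> \<tau> N) (nanoword_pairing \<alpha> \<tau> N')"
proof -
  let ?P = "(nanoword_pairing \<alpha> \<tau> N)\<lparr>elems := insert None (Some ` letters N')\<rparr>"
  have "elems (nanoword_pairing \<alpha> \<tau> N) - Some ` Z = insert None (Some ` letters N')"
    by (auto simp: sel)
  with del have "pairing_step \<alpha> \<tau> (nanoword_pairing \<alpha> \<tau> N) ?P"
    by simp
  moreover have "pairing_step \<alpha> \<tau> ?P (nanoword_pairing \<alpha> \<tau> N')"
  proof (rule pairing_step.iso)
    show "is_pairing \<alpha> \<tau> ?P"
      by (intro is_pairing_restrict is_pairing_nanoword_pairing tau nw) (auto simp: sel)
    show "is_pairing \<alpha> \<tau> (nanoword_pairing \<alpha> \<tau> N')"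
      by (intro is_pairing_nanoword_pairing tau nw')
    have "nanoword_form \<alpha> \<tau> N' X Y = nanoword_form \<alpha> \<tau> N X Y"
      if "X \<in> insert None (Some ` letters N')" "Y \<in> insert None (Some ` letters N')" for X Y
    proof -
      have "X \<in> insert None (Some ` letters N)" "Y \<in> insert None (Some ` letters N)"
        using that by (auto simp: sel(1))
      then show ?thesis
        using same[OF that] that by (simp only: nanoword_form_eq_pi_class tau nw nw')
    qed
    then show "pairing_iso ?P (nanoword_pairing \<alpha> \<tau> N')"
      unfolding pairing_iso_def
      by (intro exI[of _ id] conjI ballI) (simp_all add: sel(2))
  qed
  ultimately show ?thesis
    by (meson equivclp_into_equivclp r_into_equivclp)
qed

section \<open>Comparing words\<close>

text \<open>
  Removing a block shifts the later positions to the left and thus keeps the order of the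
  occurrences of all letters outside the block.
\<close>

lemma encl_delete_block:
  assumes "count_list (x @ u @ y) D = 2" "count_list (x @ u @ y) F = 2" "D \<notin> set u" "F \<notin> set u"
  shows "encl_first (x @ u @ y) D F = encl_first (x @ y) D F"
    "encl_last (x @ u @ y) D F = encl_last (x @ y) D F"
proof -
  \<comment> \<open>The position in the long word of the letter at position \<open>k\<close> of the short word.\<close>
  define s where "s k = (if k < length x then k else k + length u)" for k
  have mono: "s j < s k \<longleftrightarrow> j < k" for j k
    by (auto simp: s_def)
  have "first_pos (x @ u @ y) G = s (first_pos (x @ y) G) \<and> last_pos (x @ u @ y) G = s (last_pos (x @ y) G)"
    if "G \<in> {D, F}" for G
  proof -
    have two: "count_list (x @ u @ y) G = 2" and two': "count_list (x @ y) G = 2"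
      using assms that by auto
    have nth: "(x @ u @ y) ! s k = (x @ y) ! k" for k
      by (auto simp: s_def nth_append)
    have "s (last_pos (x @ y) G) < length (x @ u @ y)"
      using nth_first_last_pos(3)[OF two'] by (auto simp: s_def)
    then show ?thesis
      using first_last_pos_eqI[OF two, of "s (first_pos (x @ y) G)" "s (last_pos (x @ y) G)"]
        positions_of_two(2)[OF two'] nth_first_last_pos(1,2)[OF two'] by (simp add: mono nth)
  qed
  then show "encl_first (x @ u @ y) D F = encl_first (x @ y) D F"
    "encl_last (x @ u @ y) D F = encl_last (x @ y) D F"
    by (simp_all add: encl_first_def encl_last_def mono)
qed

lemma pos_replace_block:
  assumes "count_list (x @ u @ y) F = 2" "F \<notin> set u" "F \<notin> set v" "length u = length v"
  shows "first_pos (x @ v @ y) F = first_pos (x @ u @ y) F"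
    "last_pos (x @ v @ y) F = last_pos (x @ u @ y) F"
proof -
  have two: "count_list (x @ v @ y) F = 2"
    using assms by simp
  have nth: "(x @ v @ y) ! k = F" if "(x @ u @ y) ! k = F" for k
  proof (cases "length x \<le> k \<and> k < length x + length u")
    case True
    then have "F \<in> set u"
      using that nth_mem[of "k - length x" u] by (auto simp: nth_append split: if_splits)
    then show ?thesis using assms(2) by simp
  next
    case False
    then show ?thesis using that assms(4) by (auto simp: nth_append split: if_splits)
  qed
  show "first_pos (x @ v @ y) F = first_pos (x @ u @ y) F"
    "last_pos (x @ v @ y) F = last_pos (x @ u @ y) F"
    using first_last_pos_eqI[OF two, of "first_pos (x @ u @ y) F" "last_pos (x @ u @ y) F"]
      positions_of_two(2)[OF assms(1)] nth_first_last_pos[OF assms(1)] nth assms(4) by simp_all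
qed

text \<open>
  The sums of the two words differ only by the terms of the deleted letters, because the
  indicators of the surviving letters are the same.
\<close>

lemma sum_delete_letters:
  fixes N N' :: "('l, 'a) nanoword"
  assumes "is_nanoword \<alpha> N" "Z \<subseteq> letters N" "letters N' = letters N - Z" "proj N' = proj N"
    and encl: "\<forall>D\<in>letters N'. \<forall>F\<in>letters N'.
      encl_first (word N') D F = encl_first (word N) D F \<and> encl_last (word N') D F = encl_last (word N) D F"
    and "D \<in> letters N'"
  shows "base_sum N D = base_sum N' D
      + (\<Sum>F\<in>Z. frag_cmul (encl_first (word N) D F - encl_last (word N) D F) (frag_of (proj N F)))"
    and "E \<in> letters N' \<Longrightarrow> letter_sum N D E = letter_sum N' D E
      + frag_cmul 2 (\<Sum>F\<in>Z. frag_cmul (encl_first (word N) D F * encl_last (word N) E F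
          - encl_first (word N) E F * encl_last (word N) D F) (frag_of (proj N F)))"
proof -
  have split: "sum f (letters N) = sum f (letters N') + sum f Z" for f :: "'l \<Rightarrow> 'a \<Rightarrow>\<^sub>0 int"
    unfolding assms(3) by (rule sum.subset_diff[OF assms(2) is_nanowordD(1)[OF assms(1)]])
  show "base_sum N D = base_sum N' D
      + (\<Sum>F\<in>Z. frag_cmul (encl_first (word N) D F - encl_last (word N) D F) (frag_of (proj N F)))"
    unfolding base_sum_def split using assms(4,6) encl
    by (intro arg_cong2[where f = plus] sum.cong refl) simp
  assume E: "E \<in> letters N'"
  have "link_sum N D E = link_sum N' D E
      + (\<Sum>F\<in>Z. frag_cmul (encl_first (word N) D F * encl_last (word N) E F
          - encl_first (word N) E F * encl_last (word N) D F) (frag_of (proj N F)))"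
    unfolding link_sum_def split using assms(4,6) encl E
    by (intro arg_cong2[where f = plus] sum.cong refl) simp
  then show "letter_sum N D E = letter_sum N' D E
      + frag_cmul 2 (\<Sum>F\<in>Z. frag_cmul (encl_first (word N) D F * encl_last (word N) E F
          - encl_first (word N) E F * encl_last (word N) D F) (frag_of (proj N F)))"
    unfolding letter_sum_def using encl E assms(4,6)
    by (simp add: frag_cmul_distrib2)
qed

lemma is_nanoword_delete:
  assumes "is_nanoword \<alpha> N" "set w = set (word N) - Z"
    and "\<And>F. F \<in> letters N - Z \<Longrightarrow> count_list w F = count_list (word N) F"
  shows "is_nanoword \<alpha> (N\<lparr>letters := letters N - Z, word := w\<rparr>)"
  using assms by (auto simp: is_nanoword_def)

section \<open>Cancelling moves\<close>

text \<open>
  The two occurrences of \<open>A\<close> are adjacent. Nothing lies between them, so \<open>A\<close> is annihilating.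
  Conversely another letter encloses both occurrences or neither, so \<open>A\<close> contributes to no
  interlacing number and to no determinant, and its deletion leaves the pairing of the other
  letters unchanged.
\<close>

lemma homology_H1:
  fixes N :: "('l, 'a) nanoword"
  assumes tau: "\<tau> \<in> \<alpha> \<rightarrow> \<alpha>" and nw: "is_nanoword \<alpha> N" and A: "A \<in> letters N"
    and w: "word N = x @ [A, A] @ y" and xy: "set x \<union> set y \<subseteq> letters N - {A}"
  defines "N' \<equiv> N\<lparr>letters := letters N - {A}, word := x @ y\<rparr>"
  shows "equivclp (pairing_step \<alpha> \<tau>) (nanoword_pairing \<alpha> \<tau> N) (nanoword_pairing \<alpha> \<tau> N')"
proof -
  note two = is_nanowordD(3)[OF nw]
  have sel: "letters N' = letters N - {A}" "word N' = x @ y" "proj N' = proj N"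
    by (simp_all add: N'_def)
  have nw': "is_nanoword \<alpha> N'"
    unfolding N'_def using xy by (intro is_nanoword_delete nw) (auto simp: w)
  have posA: "first_pos (word N) A = length x" "last_pos (word N) A = Suc (length x)"
    using first_last_pos_eqI[OF two[OF A], of "length x" "Suc (length x)"]
    by (simp_all add: w nth_append)
  have other: "k \<noteq> length x \<and> k \<noteq> Suc (length x)"
    if "k \<in> positions (word N) D" "D \<noteq> A" for k D
    using that by (auto simp: positions_def w nth_append)
  have pos: "first_pos (word N) D \<in> positions (word N) D" "last_pos (word N) D \<in> positions (word N) D"
    if "D \<in> letters N" for D
    using positions_of_two(1)[OF two[OF that]] by auto
  have colA: "encl_first (word N) D A = encl_last (word N) D A" if "D \<in> letters N" for D
  proof (cases "D = A")
    case False
    then show ?thesis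
      using other[OF pos(1)[OF that]] other[OF pos(2)[OF that]]
      by (auto simp: encl_first_def encl_last_def posA of_bool_def)
  qed (simp add: encl_first_def encl_last_def)
  have rowA: "encl_first (word N) A F = 0" "encl_last (word N) A F = 0" for F
    by (simp_all add: encl_first_def encl_last_def posA)
  have encl: "\<forall>D\<in>letters N'. \<forall>F\<in>letters N'.
      encl_first (word N') D F = encl_first (word N) D F \<and> encl_last (word N') D F = encl_last (word N) D F"
  proof (intro ballI)
    fix D F assume "D \<in> letters N'" "F \<in> letters N'"
    then show "encl_first (word N') D F = encl_first (word N) D F \<and>
        encl_last (word N') D F = encl_last (word N) D F"
      using encl_delete_block[of x "[A, A]" y D F] two[of D] two[of F] by (auto simp: w sel)
  qed
  note delete = sum_delete_letters[OF nw _ sel(1,3) encl]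
  have same: "free_form N X Y = free_form N' X Y"
    if "X \<in> insert None (Some ` letters N')" "Y \<in> insert None (Some ` letters N')" for X Y
    using that A by (elim insertE imageE) (simp_all add: delete, simp_all add: sel colA)
  have zero: "free_form N (Some A) Y = 0" if "Y \<in> insert None (Some ` letters N)" for Y
  proof -
    have "encl_first (word N) D A - encl_last (word N) D A = 0" if "D \<in> letters N" for D
      using colA[OF that] by simp
    then show ?thesis
      using that by (auto simp: base_sum_def letter_sum_def link_sum_def rowA)
  qed
  have "annihilating \<alpha> \<tau> (nanoword_pairing \<alpha> \<tau> N) (Some A)"
    unfolding annihilating_def nanoword_pairing_select
  proof (intro conjI ballI)
    fix Y assume Y: "Y \<in> insert None (Some ` letters N)"
    have "Some A \<in> insert None (Some ` letters N)"
      using A by simp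
    then show "nanoword_form \<alpha> \<tau> N (Some A) Y = \<one>\<^bsub>pi_group \<alpha> \<tau>\<^esub>"
      by (simp only: nanoword_form_eq_pi_class[OF tau nw _ Y] zero[OF Y] pi_class_zero[OF tau])
  qed (use A in auto)
  then have "pairing_step \<alpha> \<tau> (nanoword_pairing \<alpha> \<tau> N)
      ((nanoword_pairing \<alpha> \<tau> N)\<lparr>elems := elems (nanoword_pairing \<alpha> \<tau> N) - {Some A}\<rparr>)"
    by (intro pairing_step.M1 is_pairing_nanoword_pairing tau nw)
  then show ?thesis
    by (intro homology_of_deletion[OF tau nw nw' sel(1,3)] arg_cong[OF same]) simp_all
qed

text \<open>
  As seen from the other letters, \<open>A\<close> and \<open>B\<close> have the same position. Hence they enter every sum
  with equal coefficients, which multiply \<open>|A| + |B|\<close>, a relator of \<open>\<pi>\<close>; so their deletion does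
  not change the pairing of the other letters. They are twins for the same reason, except that
  \<open>A\<close> encloses \<open>B\<close>: this adds \<open>n\<cdot>|B|\<close> to the linking of \<open>A\<close> with a letter \<open>E\<close>, where \<open>n\<close> is the
  interlacing number of \<open>B\<close> and \<open>E\<close>. Since linking counts twice, the pairings of \<open>A\<close> and \<open>B\<close>
  with \<open>E\<close> differ by \<open>2n|B| + n|A| - n|B| = n(|A| + |B|)\<close>, again a relator. This is why the square
  of the linking and the factors with the labels occur together in the definition.
\<close>

lemma homology_H2:
  fixes N :: "('l, 'a) nanoword"
  assumes tau: "\<tau> \<in> \<alpha> \<rightarrow> \<alpha>" and nw: "is_nanoword \<alpha> N"
    and AB: "A \<in> letters N" "B \<in> letters N" "A \<noteq> B"
    and w: "word N = x @ [A, B] @ y @ [B, A] @ z"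
    and xyz: "set x \<union> set y \<union> set z \<subseteq> letters N - {A, B}"
    and proj: "proj N A = \<tau> (proj N B)"
  defines "N' \<equiv> N\<lparr>letters := letters N - {A, B}, word := x @ y @ z\<rparr>"
  shows "equivclp (pairing_step \<alpha> \<tau>) (nanoword_pairing \<alpha> \<tau> N) (nanoword_pairing \<alpha> \<tau> N')"
proof -
  note two = is_nanowordD(3)[OF nw]
  have sel: "letters N' = letters N - {A, B}" "word N' = x @ y @ z" "proj N' = proj N"
    by (simp_all add: N'_def)
  have nw': "is_nanoword \<alpha> N'"
    unfolding N'_def using xyz by (intro is_nanoword_delete nw) (auto simp: w)
  let ?a = "length x" and ?b = "Suc (Suc (length x + length y))"
  have posA: "first_pos (word N) A = ?a" "last_pos (word N) A = Suc ?b"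
    using first_last_pos_eqI[OF two[OF AB(1)], of ?a "Suc ?b"] by (simp_all add: w nth_append)
  have posB: "first_pos (word N) B = Suc ?a" "last_pos (word N) B = ?b"
    using first_last_pos_eqI[OF two[OF AB(2)], of "Suc ?a" ?b] by (simp_all add: w nth_append)
  have nth: "word N ! ?a = A" "word N ! Suc ?a = B" "word N ! ?b = B" "word N ! Suc ?b = A"
    by (simp_all add: w nth_append)
  have other: "first_pos (word N) D \<notin> {?a, Suc ?a, ?b, Suc ?b}" "last_pos (word N) D \<notin> {?a, Suc ?a, ?b, Suc ?b}"
    if "D \<in> letters N - {A, B}" for D
    using nth_first_last_pos(1,2)[of "word N" D] two[of D] that nth by auto
  have col: "encl_first (word N) D A = encl_first (word N) D B" "encl_last (word N) D A = encl_last (word N) D B"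
    if "D \<in> letters N - {A, B}" for D
    using other[OF that] by (auto simp: encl_first_def encl_last_def posA posB of_bool_def)
  have row: "encl_first (word N) A F = encl_first (word N) B F" "encl_last (word N) A F = encl_last (word N) B F"
    if "F \<in> letters N - {B}" for F
    using other[of F] that by (cases "F = A"; auto simp: encl_first_def encl_last_def posA posB of_bool_def)+
  have row_B: "encl_first (word N) A B = 1" "encl_last (word N) A B = 1"
    "encl_first (word N) B B = 0" "encl_last (word N) B B = 0"
    by (simp_all add: encl_first_def encl_last_def posA posB)
  have encl: "\<forall>D\<in>letters N'. \<forall>F\<in>letters N'.
      encl_first (word N') D F = encl_first (word N) D F \<and> encl_last (word N') D F = encl_last (word N) D F"
  proof (intro ballI)
    fix D F assume "D \<in> letters N'" "F \<in> letters N'"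
    then show "encl_first (word N') D F = encl_first (word N) D F \<and>
        encl_last (word N') D F = encl_last (word N) D F"
      using encl_delete_block[of x "[A, B]" "y @ [B, A] @ z" D F] encl_delete_block[of "x @ y" "[B, A]" z D F]
        two[of D] two[of F] by (auto simp: w sel)
  qed
  define rel where "rel = frag_of (proj N B) + frag_of (\<tau> (proj N B))"
  have pair: "(\<Sum>F\<in>{A, B}. frag_cmul (c F) (frag_of (proj N F))) = frag_cmul (c A) rel"
    if "c A = c B" for c :: "'l \<Rightarrow> int"
    using AB(3) that by (simp add: rel_def proj frag_cmul_distrib2 add.commute)
  have "{A, B} \<subseteq> letters N"
    using AB by simp
  note delete = sum_delete_letters[OF nw this sel(1,3) encl]
  have base': "base_sum N D = base_sum N' D + frag_cmul (encl_first (word N) D A - encl_last (word N) D A) rel"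
    if "D \<in> letters N'" for D
    unfolding delete(1)[OF that] using that by (subst pair) (simp_all add: sel col)
  have letter': "letter_sum N D E = letter_sum N' D E + frag_cmul (2 * (encl_first (word N) D A * encl_last (word N) E A
        - encl_first (word N) E A * encl_last (word N) D A)) rel"
    if "D \<in> letters N'" "E \<in> letters N'" for D E
    unfolding delete(2)[OF that] using that by (subst pair) (simp_all add: sel col)
  have "\<exists>k. free_form N X Y = free_form N' X Y + frag_cmul k rel"
    if "X \<in> insert None (Some ` letters N')" "Y \<in> insert None (Some ` letters N')" for X Y
  proof -
    have "- (b + frag_cmul k rel) = - b + frag_cmul (- k) rel" for b k
      by (simp flip: minus_frag_cmul)
    moreover have "0 = 0 + frag_cmul 0 rel"
      by simp
    ultimately show ?thesis
      using that by (elim insertE imageE) (simp_all only: free_form.simps base' letter', blast+)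
  qed
  moreover have relator: "pi_class \<alpha> \<tau> (f + frag_cmul k rel) = pi_class \<alpha> \<tau> f"
    if "Poly_Mapping.keys f \<subseteq> \<alpha>" for f k
    unfolding rel_def by (rule pi_class_add_relator[OF tau that is_nanowordD(2)[OF nw AB(2)]])
  ultimately have same: "pi_class \<alpha> \<tau> (free_form N X Y) = pi_class \<alpha> \<tau> (free_form N' X Y)"
    if "X \<in> insert None (Some ` letters N')" "Y \<in> insert None (Some ` letters N')" for X Y
    using keys_free_form[OF nw'] that by metis
  have base_twin: "base_sum N A = base_sum N B"
    unfolding base_sum_def
  proof (rule sum.cong)
    fix F assume "F \<in> letters N"
    then show "frag_cmul (encl_first (word N) A F - encl_last (word N) A F) (frag_of (proj N F))
        = frag_cmul (encl_first (word N) B F - encl_last (word N) B F) (frag_of (proj N F))"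
      using row[of F] row_B by (cases "F = B") auto
  qed simp
  have letter_twin: "letter_sum N A E = letter_sum N B E
      + frag_cmul (encl_first (word N) B E - encl_last (word N) B E) rel" if E: "E \<in> letters N" for E
  proof -
    let ?n = "encl_first (word N) B E - encl_last (word N) B E"
    have n: "encl_first (word N) A E - encl_last (word N) A E = ?n"
      using row[of E] row_B E by (cases "E = B") auto
    \<comment> \<open>The determinant contributed by \<open>B\<close> to the linking of \<open>A\<close> and \<open>E\<close>, as both indicators of \<open>B\<close>
      with respect to \<open>A\<close> are \<open>1\<close>.\<close>
    have n': "encl_last (word N) E B - encl_first (word N) E B = ?n"
      using encl_skew[OF two[OF E] two[OF AB(2)]] by simp
    have "link_sum N A E = link_sum N B E + frag_cmul ?n (frag_of (proj N B))"
      unfolding link_sum_def sum.remove[OF is_nanowordD(1)[OF nw] AB(2)] n'[symmetric]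
      using row row_B by (simp add: add.commute)
    then show ?thesis
      unfolding letter_sum_def n rel_def
      by (intro poly_mapping_eqI) (simp add: lookup_add proj algebra_simps)
  qed
  have "pi_class \<alpha> \<tau> (free_form N (Some A) Y) = pi_class \<alpha> \<tau> (free_form N (Some B) Y)"
    if "Y \<in> insert None (Some ` letters N)" for Y
    using that keys_free_form[OF nw, of "Some B" Y] AB(2)
    by (auto simp: base_twin letter_twin relator)
  then have "twins \<tau> (nanoword_pairing \<alpha> \<tau> N) (Some A) (Some B)"
    unfolding twins_def nanoword_pairing_select using AB proj
    by (simp add: nanoword_form_eq_pi_class[OF tau nw] del: free_form.simps)
  then have "pairing_step \<alpha> \<tau> (nanoword_pairing \<alpha> \<tau> N)
      ((nanoword_pairing \<alpha> \<tau> N)\<lparr>elems := elems (nanoword_pairing \<alpha> \<tau> N) - {Some A, Some B}\<rparr>)"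
    by (intro pairing_step.M2 is_pairing_nanoword_pairing tau nw)
  then show ?thesis
    by (intro homology_of_deletion[OF tau nw nw' sel(1,3)] same) simp_all
qed

section \<open>Isomorphisms and the third move\<close>

lemma pairing_step_of_equal_sums:
  assumes "\<tau> \<in> \<alpha> \<rightarrow> \<alpha>" "is_nanoword \<alpha> N" "is_nanoword \<alpha> N'"
    and bij: "bij_betw f (letters N) (letters N')"
    and proj: "\<And>D. D \<in> letters N \<Longrightarrow> proj N' (f D) = proj N D"
    and base: "\<And>D. D \<in> letters N \<Longrightarrow> base_sum N' (f D) = base_sum N D"
    and letter: "\<And>D E. \<lbrakk>D \<in> letters N; E \<in> letters N\<rbrakk> \<Longrightarrow> letter_sum N' (f D) (f E) = letter_sum N D E"
  shows "pairing_step \<alpha> \<tau> (nanoword_pairing \<alpha> \<tau> N) (nanoword_pairing \<alpha> \<tau> N')"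
proof (rule pairing_step.iso)
  show "pairing_iso (nanoword_pairing \<alpha> \<tau> N) (nanoword_pairing \<alpha> \<tau> N')"
    unfolding pairing_iso_def nanoword_pairing_select
  proof (intro exI[of _ "map_option f"] conjI ballI)
    have img: "f ` letters N = letters N'" and inj: "inj_on f (letters N)"
      using bij by (auto simp: bij_betw_def)
    have "inj_on (map_option f) (insert None (Some ` letters N))"
      using inj by (auto simp: inj_on_def)
    moreover have "map_option f ` insert None (Some ` letters N) = insert None (Some ` letters N')"
      by (simp add: image_image flip: img)
    ultimately show "bij_betw (map_option f) (insert None (Some ` letters N)) (insert None (Some ` letters N'))"
      by (simp add: bij_betw_def)
    show "proj N' (the (map_option f X)) = proj N (the X)"
      if "X \<in> insert None (Some ` letters N) - {None}" for X
      using that proj by auto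
    show "nanoword_form \<alpha> \<tau> N' (map_option f X) (map_option f Y) = nanoword_form \<alpha> \<tau> N X Y"
      if X: "X \<in> insert None (Some ` letters N)" and Y: "Y \<in> insert None (Some ` letters N)" for X Y
    proof -
      have "map_option f X \<in> insert None (Some ` letters N')" "map_option f Y \<in> insert None (Some ` letters N')"
        using X Y img by auto
      moreover have "free_form N' (map_option f X) (map_option f Y) = free_form N X Y"
        using X Y base letter by (elim insertE imageE) simp_all
      ultimately show ?thesis
        by (simp only: nanoword_form_eq_pi_class[OF assms(1,3)] nanoword_form_eq_pi_class[OF assms(1,2) X Y])
    qed
  qed simp
qed (intro is_pairing_nanoword_pairing assms)+

lemma pairing_step_nanoword_iso:
  assumes tau: "\<tau> \<in> \<alpha> \<rightarrow> \<alpha>" and nw: "is_nanoword \<alpha> N" and nw': "is_nanoword \<alpha> N'"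
    and iso: "nanoword_iso N N'"
  shows "pairing_step \<alpha> \<tau> (nanoword_pairing \<alpha> \<tau> N) (nanoword_pairing \<alpha> \<tau> N')"
proof -
  obtain f where bij: "bij_betw f (letters N) (letters N')"
    and proj: "\<And>D. D \<in> letters N \<Longrightarrow> proj N' (f D) = proj N D"
    and w: "word N' = map f (word N)"
    using iso by (auto simp: nanoword_iso_def)
  have pos: "first_pos (word N') (f D) = first_pos (word N) D" "last_pos (word N') (f D) = last_pos (word N) D"
    if "D \<in> letters N" for D
  proof -
    have two: "count_list (word N) D = 2" "count_list (word N') (f D) = 2"
      using is_nanowordD(3)[OF nw that] is_nanowordD(3)[OF nw', of "f D"] bij_betwE[OF bij] that by auto
    show "first_pos (word N') (f D) = first_pos (word N) D" "last_pos (word N') (f D) = last_pos (word N) D"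
      using first_last_pos_eqI[OF two(2), of "first_pos (word N) D" "last_pos (word N) D"]
        nth_first_last_pos[OF two(1)] positions_of_two(2)[OF two(1)] by (simp_all add: w)
  qed
  have encl: "encl_first (word N') (f D) (f F) = encl_first (word N) D F"
    "encl_last (word N') (f D) (f F) = encl_last (word N) D F"
    if "D \<in> letters N" "F \<in> letters N" for D F
    using that by (simp_all add: encl_first_def encl_last_def pos)
  have "base_sum N' (f D) = base_sum N D" if "D \<in> letters N" for D
    unfolding base_sum_def sum.reindex_bij_betw[OF bij, symmetric]
    using that by (simp add: encl proj)
  moreover have "letter_sum N' (f D) (f E) = letter_sum N D E" if "D \<in> letters N" "E \<in> letters N" for D E
    unfolding letter_sum_def link_sum_def sum.reindex_bij_betw[OF bij, symmetric]
    using that by (simp add: encl proj)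
  ultimately show ?thesis
    by (intro pairing_step_of_equal_sums[OF tau nw nw' bij proj])
qed

text \<open>
  The pairing does not change at all. The move swaps three pairs of adjacent occurrences, so only
  the indicators among \<open>A\<close>, \<open>B\<close>, \<open>C\<close> change. As these letters have a common label, only the sum of
  their three coefficients matters. This sum is unchanged for the pairing of any letter with the
  distinguished element. It is unchanged for the linking of \<open>D\<close> and \<open>E\<close>, and so is their
  interlacing number, if \<open>D\<close> or \<open>E\<close> is another letter. If both are among \<open>A\<close>, \<open>B\<close>, \<open>C\<close>, then
  the linking loses what the interlacing number gains; the two changes cancel, since the linking
  counts twice and the interlacing number multiplies \<open>|D| + |E|\<close>.
\<close>

lemma pairing_step_H3:
  fixes N :: "('l, 'a) nanoword"
  assumes tau: "\<tau> \<in> \<alpha> \<rightarrow> \<alpha>" and nw: "is_nanoword \<alpha> N"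
    and ABC: "A \<in> letters N" "B \<in> letters N" "C \<in> letters N" and dist: "distinct [A, B, C]"
    and w: "word N = x @ [A, B] @ y @ [A, C] @ z @ [B, C] @ t"
    and proj: "proj N A = proj N B" "proj N B = proj N C"
  defines "N' \<equiv> N\<lparr>word := x @ [B, A] @ y @ [C, A] @ z @ [C, B] @ t\<rparr>"
  shows "pairing_step \<alpha> \<tau> (nanoword_pairing \<alpha> \<tau> N) (nanoword_pairing \<alpha> \<tau> N')"
proof -
  have sel: "letters N' = letters N" "word N' = x @ [B, A] @ y @ [C, A] @ z @ [C, B] @ t" "proj N' = proj N"
    by (simp_all add: N'_def)
  have count: "count_list (word N') D = count_list (word N) D" for D
    unfolding sel w using dist by simp
  have "set (word N') = set (word N)"
    unfolding sel w by auto
  then have nw': "is_nanoword \<alpha> N'"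
    using nw unfolding is_nanoword_def by (simp add: sel(1,3) count)
  note two = is_nanowordD(3)[OF nw] and two' = is_nanowordD(3)[OF nw', unfolded sel(1)]
  define a b c where "a = length x" and "b = Suc (Suc (length x + length y))"
    and "c = Suc (Suc (Suc (Suc (length x + length y + length z))))"
  note abc_defs = this
  have ord: "Suc a < b" "Suc b < c"
    by (simp_all add: abc_defs)
  have nth: "word N ! a = A" "word N ! Suc a = B" "word N ! b = A" "word N ! Suc b = C"
    "word N ! c = B" "word N ! Suc c = C"
    by (simp_all add: w nth_append abc_defs)
  have nth': "word N' ! a = B" "word N' ! Suc a = A" "word N' ! b = C" "word N' ! Suc b = A"
    "word N' ! c = C" "word N' ! Suc c = B"
    by (simp_all add: sel nth_append abc_defs)
  have len: "Suc c < length (word N)" "Suc c < length (word N')"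
    by (simp_all add: w sel abc_defs)
  have pos: "first_pos (word N) A = a" "last_pos (word N) A = b"
    "first_pos (word N) B = Suc a" "last_pos (word N) B = c"
    "first_pos (word N) C = Suc b" "last_pos (word N) C = Suc c"
    using first_last_pos_eqI[OF two[OF ABC(1)], of a b] first_last_pos_eqI[OF two[OF ABC(2)], of "Suc a" c]
      first_last_pos_eqI[OF two[OF ABC(3)], of "Suc b" "Suc c"] nth len(1) ord by simp_all
  have pos': "first_pos (word N') A = Suc a" "last_pos (word N') A = Suc b"
    "first_pos (word N') B = a" "last_pos (word N') B = Suc c"
    "first_pos (word N') C = b" "last_pos (word N') C = c"
    using first_last_pos_eqI[OF two'[OF ABC(1)], of "Suc a" "Suc b"] first_last_pos_eqI[OF two'[OF ABC(2)], of a "Suc c"]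
      first_last_pos_eqI[OF two'[OF ABC(3)], of b c] nth' len(2) ord by simp_all
  let ?L = "letters N - {A, B, C}"
  have pos_other: "first_pos (word N') D = first_pos (word N) D" "last_pos (word N') D = last_pos (word N) D"
    if "D \<in> ?L" for D
  proof -
    have neq: "A \<noteq> D" "B \<noteq> D" "C \<noteq> D" and two: "count_list (word N) D = 2"
      using that two[of D] by auto
    show "first_pos (word N') D = first_pos (word N) D" "last_pos (word N') D = last_pos (word N) D"
      using two neq
        pos_replace_block[of x "[A, B]" "y @ [A, C] @ z @ [B, C] @ t" D "[B, A]"]
        pos_replace_block[of "x @ [B, A] @ y" "[A, C]" "z @ [B, C] @ t" D "[C, A]"]
        pos_replace_block[of "x @ [B, A] @ y @ [C, A] @ z" "[B, C]" t D "[C, B]"]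
      by (simp_all add: w sel)
  qed
  have adjacent: "k < first_pos (word N) D \<longleftrightarrow> Suc k < first_pos (word N) D"
    "first_pos (word N) D < Suc k \<longleftrightarrow> first_pos (word N) D < k"
    "k < last_pos (word N) D \<longleftrightarrow> Suc k < last_pos (word N) D"
    "last_pos (word N) D < Suc k \<longleftrightarrow> last_pos (word N) D < k"
    if "D \<in> ?L" "k = a \<or> k = b \<or> k = c" for D k
  proof -
    have "word N ! k \<noteq> D" "word N ! Suc k \<noteq> D"
      using that nth by auto
    then have "first_pos (word N) D \<noteq> k" "first_pos (word N) D \<noteq> Suc k"
      "last_pos (word N) D \<noteq> k" "last_pos (word N) D \<noteq> Suc k"
      using nth_first_last_pos(1,2)[of "word N" D] two[of D] that(1) by auto
    then show "k < first_pos (word N) D \<longleftrightarrow> Suc k < first_pos (word N) D"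
      "first_pos (word N) D < Suc k \<longleftrightarrow> first_pos (word N) D < k"
      "k < last_pos (word N) D \<longleftrightarrow> Suc k < last_pos (word N) D"
      "last_pos (word N) D < Suc k \<longleftrightarrow> last_pos (word N) D < k"
      by linarith+
  qed
  have adj: "Suc a < p \<longleftrightarrow> a < p" "Suc b < p \<longleftrightarrow> b < p" "Suc c < p \<longleftrightarrow> c < p"
    "p < Suc a \<longleftrightarrow> p < a" "p < Suc b \<longleftrightarrow> p < b" "p < Suc c \<longleftrightarrow> p < c"
    if "D \<in> ?L" "p = first_pos (word N) D \<or> p = last_pos (word N) D" for D p
    using adjacent[OF that(1)] that(2) by auto
  note adj_first = adj[OF _ disjI1[OF refl]] and adj_last = adj[OF _ disjI2[OF refl]]
  note encl_defs = encl_first_def encl_last_def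
  have cases: "D \<in> ?L \<or> D = A \<or> D = B \<or> D = C" if "D \<in> letters N" for D
    using that by blast
  have same: "encl_first (word N') D F = encl_first (word N) D F" "encl_last (word N') D F = encl_last (word N) D F"
    if D: "D \<in> letters N" and F: "F \<in> ?L" for D F
    using cases[OF D] pos_other[of D]
    by (elim disjE; simp add: encl_defs pos_other[OF F] pos pos' adj_first[OF F] adj_last[OF F])+
  \<comment> \<open>Seen from outside there are three distinct places, one for each swapped pair. All the
    indicators are expressed by those at the places of the first and last occurrence of \<open>A\<close> and of
    the last occurrence of \<open>B\<close>.\<close>
  have col: "encl_first (word N) D B = encl_first (word N) D A" "encl_first (word N) D C = encl_last (word N) D A"
    "encl_last (word N) D C = encl_last (word N) D B"
    "encl_first (word N') D A = encl_first (word N) D A" "encl_first (word N') D B = encl_first (word N) D A"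
    "encl_first (word N') D C = encl_last (word N) D A" "encl_last (word N') D A = encl_last (word N) D A"
    "encl_last (word N') D B = encl_last (word N) D B" "encl_last (word N') D C = encl_last (word N) D B"
    if "D \<in> ?L" for D
    by (simp_all add: encl_defs pos pos' pos_other[OF that] adj_first[OF that] adj_last[OF that])
  \<comment> \<open>Before the move \<open>A\<close>, \<open>B\<close> and \<open>B\<close>, \<open>C\<close> interlace in the pattern \<open>A B A C B C\<close>; after it, in
    the pattern \<open>B A C A C B\<close>, the letters \<open>A\<close>, \<open>C\<close> interlace and \<open>B\<close> encloses both.\<close>
  have table:
    "encl_first (word N) A A = 0" "encl_first (word N) A B = 1" "encl_first (word N) A C = 0"
    "encl_last (word N) A A = 0" "encl_last (word N) A B = 0" "encl_last (word N) A C = 0"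
    "encl_first (word N) B A = 0" "encl_first (word N) B B = 0" "encl_first (word N) B C = 1"
    "encl_last (word N) B A = 1" "encl_last (word N) B B = 0" "encl_last (word N) B C = 0"
    "encl_first (word N) C A = 0" "encl_first (word N) C B = 0" "encl_first (word N) C C = 0"
    "encl_last (word N) C A = 0" "encl_last (word N) C B = 1" "encl_last (word N) C C = 0"
    using ord by (simp_all add: encl_defs pos)
  have table':
    "encl_first (word N') A A = 0" "encl_first (word N') A B = 0" "encl_first (word N') A C = 1"
    "encl_last (word N') A A = 0" "encl_last (word N') A B = 0" "encl_last (word N') A C = 0"
    "encl_first (word N') B A = 1" "encl_first (word N') B B = 0" "encl_first (word N') B C = 1"
    "encl_last (word N') B A = 1" "encl_last (word N') B B = 0" "encl_last (word N') B C = 1"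
    "encl_first (word N') C A = 0" "encl_first (word N') C B = 0" "encl_first (word N') C C = 0"
    "encl_last (word N') C A = 1" "encl_last (word N') C B = 0" "encl_last (word N') C C = 0"
    using ord by (simp_all add: encl_defs pos')
  have sum_eq: "(\<Sum>F\<in>letters N. frag_cmul (c' F) (frag_of (proj N F)))
      = (\<Sum>F\<in>letters N. frag_cmul (c F) (frag_of (proj N F)))
        + frag_cmul ((c' A + c' B + c' C) - (c A + c B + c C)) (frag_of (proj N A))"
    if "\<And>F. F \<in> ?L \<Longrightarrow> c' F = c F" for c c' :: "'l \<Rightarrow> int"
  proof -
    have split: "(\<Sum>F\<in>letters N. frag_cmul (d F) (frag_of (proj N F))) =
        (\<Sum>F\<in>?L. frag_cmul (d F) (frag_of (proj N F))) + frag_cmul (d A + d B + d C) (frag_of (proj N A))"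
      for d :: "'l \<Rightarrow> int"
    proof -
      have "{A, B, C} \<subseteq> letters N"
        using ABC by simp
      from sum.subset_diff[OF this is_nanowordD(1)[OF nw], of "\<lambda>F. frag_cmul (d F) (frag_of (proj N F))"] show ?thesis
        using dist proj by (simp add: frag_cmul_distrib add.assoc)
    qed
    show ?thesis
      unfolding split using that
      by (simp add: frag_cmul_diff_distrib)
  qed
  have base: "base_sum N' D = base_sum N D" if D: "D \<in> letters N" for D
  proof -
    let ?c = "\<lambda>M F. encl_first (word M) D F - encl_last (word M) D F"
    have "?c N' A + ?c N' B + ?c N' C = ?c N A + ?c N B + ?c N C"
      using cases[OF D] by (elim disjE) (simp_all add: col table table')
    then show ?thesis
      unfolding base_sum_def sel(1,3) using same[OF D]
      by (subst sum_eq[of "?c N'" "?c N"]) simp_all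
  qed
  have letter: "letter_sum N' D E = letter_sum N D E" if D: "D \<in> letters N" and E: "E \<in> letters N" for D E
  proof -
    let ?n = "\<lambda>M. encl_first (word M) D E - encl_last (word M) D E"
    let ?c = "\<lambda>M F. encl_first (word M) D F * encl_last (word M) E F - encl_first (word M) E F * encl_last (word M) D F"
    let ?m = "(?c N' A + ?c N' B + ?c N' C) - (?c N A + ?c N B + ?c N C)"
    have link: "link_sum N' D E = link_sum N D E + frag_cmul ?m (frag_of (proj N A))"
      unfolding link_sum_def sel(1,3) using same[OF D] same[OF E]
      by (subst sum_eq[of "?c N'" "?c N"]) simp_all
    \<comment> \<open>The second alternative is the case that \<open>D\<close> and \<open>E\<close> both take part in the move.\<close>
    have "?m = 0 \<and> ?n N' = ?n N \<or>
        ?m + ?n N' = ?n N \<and> proj N D = proj N A \<and> proj N E = proj N A"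
      using cases[OF D] cases[OF E] D E proj
      by (elim disjE) (simp_all add: col table table' same)
    then show ?thesis
    proof (elim disjE conjE)
      assume "?m = 0" "?n N' = ?n N"
      then show ?thesis
        unfolding letter_sum_def link sel(3) by simp
    next
      assume n: "?m + ?n N' = ?n N" and "proj N D = proj N A" "proj N E = proj N A"
      then show ?thesis
        unfolding letter_sum_def link sel(3) n[symmetric]
        by (intro poly_mapping_eqI) (simp add: lookup_add algebra_simps)
    qed
  qed
  show ?thesis
    by (rule pairing_step_of_equal_sums[where f = id]) (simp_all add: tau nw nw' sel(1,3) base letter)
qed

section \<open>Invariance under homotopy\<close>

lemma homology_of_nanoword_step:
  assumes "\<tau> \<in> \<alpha> \<rightarrow> \<alpha>" "nanoword_step \<alpha> \<tau> N N'"
  shows "equivclp (pairing_step \<alpha> \<tau>) (nanoword_pairing \<alpha> \<tau> N) (nanoword_pairing \<alpha> \<tau> N')"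
  using assms(2)
proof cases
  case iso
  then show ?thesis
    by (intro r_into_equivclp pairing_step_nanoword_iso assms(1))
next
  case (H1 A x y)
  show ?thesis
    unfolding H1(1) by (rule homology_H1[OF assms(1) H1(2-5)])
next
  case (H2 A B x y z)
  show ?thesis
    unfolding H2(1) by (rule homology_H2[OF assms(1) H2(2-8)])
next
  case (H3 A B C x y z t)
  show ?thesis
    unfolding H3(1) by (rule r_into_equivclp, rule pairing_step_H3[OF assms(1) H3(2-6,7,9,10)])
qed

theorem theorem6p5:
  fixes \<alpha> :: "'a set" and \<tau> :: "'a \<Rightarrow> 'a" and N N' :: "('l, 'a) nanoword"
  assumes "\<tau> \<in> \<alpha> \<rightarrow> \<alpha>" and "\<forall>a\<in>\<alpha>. \<tau> (\<tau> a) = a"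
    and "is_nanoword \<alpha> N" and "is_nanoword \<alpha> N'"
    and "homotopic \<alpha> \<tau> N N'"
  shows "homologous \<alpha> \<tau> (nanoword_pairing \<alpha> \<tau> N) (nanoword_pairing \<alpha> \<tau> N')"
proof -
  have "equivclp (nanoword_step \<alpha> \<tau>) N N'"
    using assms(5) by (simp add: homotopic_def)
  then have "equivclp (pairing_step \<alpha> \<tau>) (nanoword_pairing \<alpha> \<tau> N) (nanoword_pairing \<alpha> \<tau> N')"
  proof (induction rule: equivclp_induct)
    case base
    show ?case by (rule equivclp_refl)
  next
    case (step M M')
    then have "equivclp (pairing_step \<alpha> \<tau>) (nanoword_pairing \<alpha> \<tau> M) (nanoword_pairing \<alpha> \<tau> M')"
      using homology_of_nanoword_step[OF assms(1)] equivclp_sym by metis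
    with step.IH show ?case by (rule equivclp_trans)
  qed
  then show ?thesis
    by (simp add: homologous_def is_pairing_nanoword_pairing assms(1,3,4))
qed

end
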